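(* Let $G$ be a graph containing no member of $\mathcal{H}=\{C_6,C_6^1,C_6^2,C_6^3\}$ as an induced subgraph, and let $G^*$ be its auxiliary graph. Then $\chi_{cd}(G)=k(G^* )$.
   Context: Graphs are finite, simple, undirected, without isolated vertices. $C_6$ is the $6$-cycle, with bipartition into independent sets $A,B$ of size $3$; $C_6^1,C_6^2,C_6^3$ are obtained from $C_6$ by adding respectively $1,2,3$ edges among the three vertices of one of the two parts. The auxiliary graph $G^*$ has vertex set $V(G)$ and edge set $\{uv: d_G(u,v)=2\}$. $k(\cdot)$ denotes the clique cover number (minimum number of cliques partitioning the vertex set). A cd-colouring is a proper colouring in which every colour class $C$ satisfies $C\subseteq N_G(v)$ for some vertex $v$; $\chi_{cd}(G)$ is the minimum number of colours in a cd-colouring. *)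

theory Defs
  imports "Graph_Theory.Graph_Theory" "HOL-Library.Disjoint_Sets"
begin

definition neighbourhood :: "('a, 'b) pre_digraph \<Rightarrow> 'a \<Rightarrow> 'a set" where
  "neighbourhood G v = {u. v \<rightarrow>\<^bsub>G\<^esub> u}"

(* The least number of edges of a u-v walk; infinite if there is none. *)
definition graph_dist :: "('a, 'b) pre_digraph \<Rightarrow> 'a \<Rightarrow> 'a \<Rightarrow> ereal" where
  "graph_dist G u v = wf_digraph.\<mu> G (\<lambda>_. 1) u v"

definition aux_graph :: "('a, 'b) pre_digraph \<Rightarrow> 'a pair_pre_digraph" where
  "aux_graph G = \<lparr> pverts = verts G,
     parcs = {(u, v). u \<in> verts G \<and> v \<in> verts G \<and> graph_dist G u v = 2} \<rparr>"

definition contains_induced :: "('a, 'b) pre_digraph \<Rightarrow> ('c, 'd) pre_digraph \<Rightarrow> bool" where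
  "contains_induced G H \<longleftrightarrow> (\<exists>K. induced_subgraph K G \<and> digraph_iso H K)"

(* The 6-cycle 0-1-2-3-4-5-0, whose parts are {0,2,4} and {1,3,5}, with the edges in E added. *)
definition C6_plus :: "nat rel \<Rightarrow> nat pair_pre_digraph" where
  "C6_plus E = (let R = {(i, (i + 1) mod 6) | i. i < 6} \<union> E in
     \<lparr> pverts = {..<6}, parcs = R \<union> R\<inverse> \<rparr>)"

(* For each number k of added edges, all choices of part and of k edges inside it
   give isomorphic graphs. *)
definition C6_family :: "nat pair_pre_digraph set" where
  "C6_family = {C6_plus {}, C6_plus {(0, 2)}, C6_plus {(0, 2), (2, 4)},
     C6_plus {(0, 2), (2, 4), (4, 0)}}"

definition clique :: "('a, 'b) pre_digraph \<Rightarrow> 'a set \<Rightarrow> bool" where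
  "clique G K \<longleftrightarrow> K \<subseteq> verts G \<and> pairwise (\<lambda>u v. u \<rightarrow>\<^bsub>G\<^esub> v) K"

definition clique_cover :: "('a, 'b) pre_digraph \<Rightarrow> 'a set set \<Rightarrow> bool" where
  "clique_cover G P \<longleftrightarrow> finite P \<and> partition_on (verts G) P \<and> (\<forall>K\<in>P. clique G K)"

definition clique_cover_number :: "('a, 'b) pre_digraph \<Rightarrow> nat" where
  "clique_cover_number G = (LEAST k. \<exists>P. clique_cover G P \<and> card P = k)"

definition proper_colouring :: "('a, 'b) pre_digraph \<Rightarrow> ('a \<Rightarrow> nat) \<Rightarrow> bool" where
  "proper_colouring G c \<longleftrightarrow> (\<forall>u v. u \<rightarrow>\<^bsub>G\<^esub> v \<longrightarrow> c u \<noteq> c v)"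

definition cd_colouring :: "('a, 'b) pre_digraph \<Rightarrow> ('a \<Rightarrow> nat) \<Rightarrow> bool" where
  "cd_colouring G c \<longleftrightarrow> proper_colouring G c \<and>
     (\<forall>i \<in> c ` verts G. \<exists>v \<in> verts G. {u \<in> verts G. c u = i} \<subseteq> neighbourhood G v)"

definition cd_chromatic_number :: "('a, 'b) pre_digraph \<Rightarrow> nat" where
  "cd_chromatic_number G = (LEAST k. \<exists>c. cd_colouring G c \<and> card (c ` verts G) = k)"

end

theory Submission
  imports Defs
begin

text \<open>A nonempty set of vertices is a clique of \<open>G\<^sup>*\<close> iff it is independent in \<open>G\<close> and
  contained in a neighbourhood, so cd-colourings and clique covers of \<open>G\<^sup>*\<close> are the same
  partitions. The nontrivial point is a Helly property: let \<open>K\<close> be a minimal nonempty clique of \<open>G\<^sup>*\<close>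
  without a common neighbour. Then \<open>K\<close> has three distinct elements \<open>a\<close>, \<open>b\<close>, \<open>c\<close>, and by
  minimality there are \<open>x\<close>, \<open>y\<close>, \<open>z\<close> such that \<open>x\<close> is adjacent to all of \<open>K\<close> except \<open>a\<close>, and
  likewise for \<open>y\<close>, \<open>b\<close> and \<open>z\<close>, \<open>c\<close>. These six vertices induce \<open>C\<^sub>6\<close> with some edges added
  among \<open>x\<close>, \<open>y\<close>, \<open>z\<close>, a member of the forbidden family.\<close>

section \<open>Adjacency and distances one and two\<close>

lemma (in graph) dominates_sym: "u \<rightarrow>\<^bsub>G\<^esub> v \<longleftrightarrow> v \<rightarrow>\<^bsub>G\<^esub> u"
  using sym_arcs by (auto simp: symmetric_def dest: symD)

lemma (in graph) dominates_irrefl: "\<not> v \<rightarrow>\<^bsub>G\<^esub> v"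
  using no_loops by (auto simp: arcs_ends_conv)

lemma (in wf_digraph) graph_dist_eq_INF_length:
  "graph_dist G u v = (INF p\<in>{p. awalk u p v}. ereal (real (length p)))"
proof -
  have "awalk_cost (\<lambda>_. 1) p = real (length p)" for p
    by (induct p) auto
  then show ?thesis by (simp add: graph_dist_def \<mu>_def)
qed

text \<open>Walk lengths are integers, so an upper bound on the infimum is witnessed by an actual
  walk.\<close>

lemma (in wf_digraph) graph_dist_le_iff:
  "graph_dist G u v \<le> ereal (real n) \<longleftrightarrow> (\<exists>p. awalk u p v \<and> length p \<le> n)"
proof
  assume "graph_dist G u v \<le> ereal (real n)"
  \<comment> \<open>Only a strict bound on an infimum yields a witness. For an integer length, being
    below \<open>n + 1\<close> means being at most \<open>n\<close>.\<close>
  then have "graph_dist G u v < ereal (real n + 1)"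
    by (rule le_less_trans) simp
  then obtain p where "awalk u p v" "ereal (real (length p)) < ereal (real n + 1)"
    unfolding graph_dist_eq_INF_length by (auto simp: INF_less_iff)
  then show "\<exists>p. awalk u p v \<and> length p \<le> n"
    by (intro exI[of _ p]) auto
next
  assume "\<exists>p. awalk u p v \<and> length p \<le> n"
  then show "graph_dist G u v \<le> ereal (real n)"
    unfolding graph_dist_eq_INF_length by (auto intro: INF_lower2)
qed

lemma (in wf_digraph) graph_dist_le_1_iff:
  assumes "u \<in> verts G"
  shows "graph_dist G u v \<le> 1 \<longleftrightarrow> u = v \<or> u \<rightarrow>\<^bsub>G\<^esub> v"
proof -
  have "(\<exists>p. awalk u p v \<and> length p \<le> 1) \<longleftrightarrow> u = v \<or> u \<rightarrow>\<^bsub>G\<^esub> v"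
  proof
    assume "\<exists>p. awalk u p v \<and> length p \<le> 1"
    then obtain p where p: "awalk u p v" "length p \<le> 1" by blast
    then show "u = v \<or> u \<rightarrow>\<^bsub>G\<^esub> v"
      by (cases p) (auto simp: awalk_Nil_iff awalk_Cons_iff arc_to_ends_def arcs_ends_conv)
  next
    assume "u = v \<or> u \<rightarrow>\<^bsub>G\<^esub> v"
    then show "\<exists>p. awalk u p v \<and> length p \<le> 1"
    proof
      assume "u = v"
      then show ?thesis using assms by (intro exI[of _ "[]"]) (simp add: awalk_Nil_iff)
    next
      assume "u \<rightarrow>\<^bsub>G\<^esub> v"
      then obtain e where "e \<in> arcs G" "tail G e = u" "head G e = v"
        by (auto simp: arcs_ends_conv)
      then show ?thesis by (intro exI[of _ "[e]"]) (auto simp: awalk_def)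
    qed
  qed
  then show ?thesis using graph_dist_le_iff[of u v 1] by (simp add: one_ereal_def)
qed

text \<open>Removing the first arc from a walk of length at most two leaves a walk of length at most
  one, to which the previous characterisation applies. Conversely, the two arcs through
  \<open>w\<close> bound the distance above, and the exclusion of shorter walks bounds it
  below.\<close>

lemma (in wf_digraph) graph_dist_eq_2_iff:
  assumes "u \<in> verts G"
  shows "graph_dist G u v = 2 \<longleftrightarrow>
    u \<noteq> v \<and> \<not> u \<rightarrow>\<^bsub>G\<^esub> v \<and> (\<exists>w. u \<rightarrow>\<^bsub>G\<^esub> w \<and> w \<rightarrow>\<^bsub>G\<^esub> v)"
proof
  assume d: "graph_dist G u v = 2"
  then have "graph_dist G u v \<le> ereal (real 2)" by simp
  then obtain p where p: "awalk u p v" "length p \<le> 2" by (auto simp only: graph_dist_le_iff)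
  have "\<not> graph_dist G u v \<le> 1" using d by (simp add: one_ereal_def)
  then have far: "u \<noteq> v" "\<not> u \<rightarrow>\<^bsub>G\<^esub> v" using graph_dist_le_1_iff[OF assms] by auto
  obtain e es where "p = e # es" using p far by (cases p) (auto simp: awalk_Nil_iff)
  then have e: "e \<in> arcs G" "u = tail G e" "awalk (head G e) es v" "length es \<le> 1"
    using p by (auto simp: awalk_Cons_iff)
  then have ue: "u \<rightarrow>\<^bsub>G\<^esub> head G e" by (auto simp: arcs_ends_conv)
  have "graph_dist G (head G e) v \<le> ereal (real 1)"
    unfolding graph_dist_le_iff using e by blast
  then have "head G e = v \<or> head G e \<rightarrow>\<^bsub>G\<^esub> v"
    using graph_dist_le_1_iff e(1) by (simp add: one_ereal_def)
  with ue far show "u \<noteq> v \<and> \<not> u \<rightarrow>\<^bsub>G\<^esub> v \<and> (\<exists>w. u \<rightarrow>\<^bsub>G\<^esub> w \<and> w \<rightarrow>\<^bsub>G\<^esub> v)"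
    by auto
next
  assume a: "u \<noteq> v \<and> \<not> u \<rightarrow>\<^bsub>G\<^esub> v \<and> (\<exists>w. u \<rightarrow>\<^bsub>G\<^esub> w \<and> w \<rightarrow>\<^bsub>G\<^esub> v)"
  then obtain e f where "e \<in> arcs G" "f \<in> arcs G" "tail G e = u" "head G e = tail G f" "head G f = v"
    by (auto simp: arcs_ends_conv)
  then have "awalk u [e, f] v" by (auto simp: awalk_def)
  then have le: "graph_dist G u v \<le> ereal (real 2)"
    unfolding graph_dist_le_iff by (intro exI[of _ "[e, f]"]) simp
  have far: "\<not> (\<exists>p. awalk u p v \<and> length p \<le> 1)"
    using a graph_dist_le_1_iff[OF assms] graph_dist_le_iff[of u v 1] by (simp add: one_ereal_def)
  have "2 \<le> length p" if "awalk u p v" for p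
    using far that by (auto simp: not_le)
  then have "2 \<le> graph_dist G u v"
    unfolding graph_dist_eq_INF_length by (auto intro!: INF_greatest)
  with le show "graph_dist G u v = 2" by (simp add: antisym)
qed

section \<open>Induced copies and the forbidden hexagons\<close>

text \<open>Reduces the search for an induced copy to a map on vertices: once \<open>f\<close>
  preserves and reflects adjacency, the map on arcs is forced, because \<open>G\<close> has no
  parallel arcs.\<close>

lemma contains_inducedI:
  fixes G :: "('a, 'b) pre_digraph" and H :: "'c pair_pre_digraph"
  assumes G: "nomulti_digraph G"
    and wf: "pair_wf_digraph H"
    and inj: "inj_on f (pverts H)"
    and f: "f ` pverts H \<subseteq> verts G"
    and arcs: "\<And>i j. i \<in> pverts H \<Longrightarrow> j \<in> pverts H \<Longrightarrow> (i, j) \<in> parcs H \<longleftrightarrow> f i \<rightarrow>\<^bsub>G\<^esub> f j"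
  shows "contains_induced G (with_proj H)"
proof -
  interpret G: nomulti_digraph G by fact
  interpret H: pair_wf_digraph H by fact
  define K where "K = G \<restriction> (f ` pverts H)"
  have K: "induced_subgraph K G"
    unfolding K_def using f by (rule G.induced_induce)
  define g where "g p = (SOME e. e \<in> arcs G \<and> tail G e = f (fst p) \<and> head G e = f (snd p))" for p
  have g: "g p \<in> arcs G \<and> tail G (g p) = f (fst p) \<and> head G (g p) = f (snd p)"
    if "p \<in> parcs H" for p
  proof -
    have "fst p \<in> pverts H" "snd p \<in> pverts H"
      using that H.arc_fst_in_verts H.arc_snd_in_verts by auto
    then have "f (fst p) \<rightarrow>\<^bsub>G\<^esub> f (snd p)" using arcs[of "fst p" "snd p"] that by simp
    then have "\<exists>e. e \<in> arcs G \<and> tail G e = f (fst p) \<and> head G e = f (snd p)"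
      by (auto simp: arcs_ends_conv)
    then show ?thesis unfolding g_def by (rule someI_ex)
  qed
  \<comment> \<open>Head and tail are taken from \<open>G\<close>, so that the image of
    \<open>H\<close> is equal to \<open>K\<close> as a record.\<close>
  define hom where "hom = \<lparr> iso_verts = f, iso_arcs = g, iso_head = head G, iso_tail = tail G \<rparr>"
  have "inj_on g (parcs H)"
  proof (rule inj_onI)
    fix p q assume pq: "p \<in> parcs H" "q \<in> parcs H" "g p = g q"
    then have "f (fst p) = f (fst q)" "f (snd p) = f (snd q)"
      using g[of p] g[of q] by auto
    moreover have "fst p \<in> pverts H" "snd p \<in> pverts H" "fst q \<in> pverts H" "snd q \<in> pverts H"
      using pq H.arc_fst_in_verts H.arc_snd_in_verts by auto
    ultimately show "p = q" using inj by (auto simp: inj_on_eq_iff prod_eq_iff)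
  qed
  then have "H.digraph_isomorphism hom"
    using inj g H.wf_digraph unfolding H.digraph_isomorphism_def hom_def by auto
  moreover have "K = app_iso hom (with_proj H)"
  proof -
    have "arcs K = g ` parcs H"
    proof
      show "g ` parcs H \<subseteq> arcs K"
        using g H.arc_fst_in_verts H.arc_snd_in_verts by (fastforce simp: K_def)
      show "arcs K \<subseteq> g ` parcs H"
      proof
        fix e assume "e \<in> arcs K"
        then obtain i j where e: "e \<in> arcs G" "tail G e = f i" "head G e = f j"
          and ij: "i \<in> pverts H" "j \<in> pverts H"
          by (auto simp: K_def)
        then have "f i \<rightarrow>\<^bsub>G\<^esub> f j" by (auto simp: arcs_ends_conv intro: rev_image_eqI)
        then have p: "(i, j) \<in> parcs H" using arcs ij by simp
        then have "e = g (i, j)"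
          using e g[OF p] by (intro G.no_multi_arcs) (auto simp: arc_to_ends_def)
        with p show "e \<in> g ` parcs H" by blast
      qed
    qed
    then show ?thesis by (simp add: K_def hom_def app_iso_def)
  qed
  ultimately show ?thesis
    using K unfolding contains_induced_def digraph_iso_def by blast
qed

text \<open>The cycle is \<open>x c y a z b\<close>, so that \<open>x\<close>, \<open>y\<close>, \<open>z\<close> are opposite to \<open>a\<close>, \<open>b\<close>, \<open>c\<close>;
  adjacency among \<open>x\<close>, \<open>y\<close>, \<open>z\<close> is left open.\<close>

definition hexagon :: "('a, 'b) pre_digraph \<Rightarrow> 'a \<Rightarrow> 'a \<Rightarrow> 'a \<Rightarrow> 'a \<Rightarrow> 'a \<Rightarrow> 'a \<Rightarrow> bool" where
  "hexagon G a b c x y z \<longleftrightarrow>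
    \<not> a \<rightarrow>\<^bsub>G\<^esub> b \<and> \<not> b \<rightarrow>\<^bsub>G\<^esub> c \<and> \<not> c \<rightarrow>\<^bsub>G\<^esub> a \<and>
    \<not> x \<rightarrow>\<^bsub>G\<^esub> a \<and> x \<rightarrow>\<^bsub>G\<^esub> b \<and> x \<rightarrow>\<^bsub>G\<^esub> c \<and>
    y \<rightarrow>\<^bsub>G\<^esub> a \<and> \<not> y \<rightarrow>\<^bsub>G\<^esub> b \<and> y \<rightarrow>\<^bsub>G\<^esub> c \<and>
    z \<rightarrow>\<^bsub>G\<^esub> a \<and> z \<rightarrow>\<^bsub>G\<^esub> b \<and> \<not> z \<rightarrow>\<^bsub>G\<^esub> c"

text \<open>The definition is invariant under a simultaneous cyclic shift of both triples. This
  moves added edges to the positions fixed in \<open>C6_family\<close>.\<close>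

lemma (in graph) hexagon_rotate: "hexagon G a b c x y z \<Longrightarrow> hexagon G b c a y z x"
  by (auto simp: hexagon_def)

text \<open>The set \<open>E\<close> records which pairs among \<open>x\<close>, \<open>y\<close>,
  \<open>z\<close> are adjacent. Numbering the hexagon in cyclic order from \<open>x\<close> puts
  these three at 0, 2, 4, the part where \<open>E\<close> may add edges.\<close>

lemma (in graph) hexagon_contains_C6_plus:
  assumes hex: "hexagon G a b c x y z"
    and E: "E \<subseteq> {(0, 2), (2, 4), (4, 0)}"
    and xy: "x \<rightarrow>\<^bsub>G\<^esub> y \<longleftrightarrow> (0, 2) \<in> E"
    and yz: "y \<rightarrow>\<^bsub>G\<^esub> z \<longleftrightarrow> (2, 4) \<in> E"
    and zx: "z \<rightarrow>\<^bsub>G\<^esub> x \<longleftrightarrow> (4, 0) \<in> E"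
  shows "contains_induced G (with_proj (C6_plus E))"
proof -
  have six: "{..<6} = {0, 1, 2, 3, 4, 5 :: nat}" by auto
  have "{(i, (i + 1) mod 6) | i. i < (6::nat)} = (\<lambda>i. (i, (i + 1) mod 6)) ` {..<6}" by auto
  also have "\<dots> = {(0, 1), (1, 2), (2, 3), (3, 4), (4, 5), (5, 0)}"
    unfolding six by simp (simp add: numeral_2_eq_2)
  finally have cyc: "{(i, (i + 1) mod 6) | i. i < (6::nat)} = \<dots>" .
  have pv: "pverts (C6_plus E) = {0, 1, 2, 3, 4, 5}"
    by (simp add: C6_plus_def Let_def six)
  have pa: "(i, j) \<in> parcs (C6_plus E) \<longleftrightarrow>
      (i, j) \<in> {(0, 1), (1, 2), (2, 3), (3, 4), (4, 5), (5, 0)} \<or>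
      (j, i) \<in> {(0, 1), (1, 2), (2, 3), (3, 4), (4, 5), (5, 0)} \<or> (i, j) \<in> E \<or> (j, i) \<in> E" for i j
    unfolding C6_plus_def Let_def cyc by auto
  have wf: "pair_wf_digraph (C6_plus E)"
    by unfold_locales (use E in \<open>auto simp: pv pa\<close>)
  note adj = hex[unfolded hexagon_def]
  have adj': "\<not> b \<rightarrow>\<^bsub>G\<^esub> a" "\<not> c \<rightarrow>\<^bsub>G\<^esub> b" "\<not> a \<rightarrow>\<^bsub>G\<^esub> c"
    "\<not> a \<rightarrow>\<^bsub>G\<^esub> x" "b \<rightarrow>\<^bsub>G\<^esub> x" "c \<rightarrow>\<^bsub>G\<^esub> x"
    "a \<rightarrow>\<^bsub>G\<^esub> y" "\<not> b \<rightarrow>\<^bsub>G\<^esub> y" "c \<rightarrow>\<^bsub>G\<^esub> y"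
    "a \<rightarrow>\<^bsub>G\<^esub> z" "b \<rightarrow>\<^bsub>G\<^esub> z" "\<not> c \<rightarrow>\<^bsub>G\<^esub> z"
    using adj dominates_sym by blast+
  have edges': "y \<rightarrow>\<^bsub>G\<^esub> x \<longleftrightarrow> (0, 2) \<in> E" "z \<rightarrow>\<^bsub>G\<^esub> y \<longleftrightarrow> (2, 4) \<in> E" "x \<rightarrow>\<^bsub>G\<^esub> z \<longleftrightarrow> (4, 0) \<in> E"
    using xy yz zx dominates_sym by metis+
  \<comment> \<open>Each of \<open>x\<close>, \<open>y\<close>, \<open>z\<close> misses a different
    one of \<open>a\<close>, \<open>b\<close>, \<open>c\<close>, which separates vertices within
    each triple. Across the triples, each of \<open>x\<close>, \<open>y\<close>, \<open>z\<close>
    has neighbours among \<open>a\<close>, \<open>b\<close>, \<open>c\<close>, while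
    \<open>a\<close>, \<open>b\<close>, \<open>c\<close> have none there.\<close>
  have dist: "distinct [x, c, y, a, z, b]"
    using adj adj' dominates_irrefl by auto
  have notE: "(i, j) \<notin> E" if "(i, j) \<notin> {(0, 2), (2, 4), (4, 0)}" for i j
    using E that by blast
  define f where "f i = [x, c, y, a, z, b] ! i" for i
  have f: "f 0 = x" "f (Suc 0) = c" "f 2 = y" "f 3 = a" "f 4 = z" "f 5 = b"
    by (simp_all add: f_def)
  show ?thesis
  proof (rule contains_inducedI[where f = f])
    show "nomulti_digraph G" by (rule nomulti_digraph)
    show "inj_on f (pverts (C6_plus E))" using dist by (auto simp: pv f inj_on_def)
    show "f ` pverts (C6_plus E) \<subseteq> verts G"
      using adj adj_in_verts by (auto simp: pv f)
    show "(i, j) \<in> parcs (C6_plus E) \<longleftrightarrow> f i \<rightarrow>\<^bsub>G\<^esub> f j"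
      if "i \<in> pverts (C6_plus E)" "j \<in> pverts (C6_plus E)" for i j
      using that unfolding pv
      \<comment> \<open>One case for each of the 36 ordered pairs of vertices.\<close>
      by (elim insertE emptyE)
        (simp_all add: pa f notE adj adj' xy yz zx edges' dominates_irrefl)
  qed (fact wf)
qed

lemma (in graph) no_hexagon:
  assumes H_free: "\<And>H. H \<in> C6_family \<Longrightarrow> \<not> contains_induced G (with_proj H)"
  shows "\<not> hexagon G a b c x y z"
proof
  assume hex: "hexagon G a b c x y z"
  note hex' = hexagon_rotate[OF hex]
  note hex'' = hexagon_rotate[OF hex']
  have free: "\<not> contains_induced G (with_proj (C6_plus E))"
    if "E \<in> {{}, {(0, 2)}, {(0, 2), (2, 4)}, {(0, 2), (2, 4), (4, 0)}}" for E
    using H_free that unfolding C6_family_def by auto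
  have *: False if "hexagon G a b c x y z" "E \<in> {{}, {(0, 2)}, {(0, 2), (2, 4)}, {(0, 2), (2, 4), (4, 0)}}"
    "x \<rightarrow>\<^bsub>G\<^esub> y \<longleftrightarrow> (0, 2) \<in> E" "y \<rightarrow>\<^bsub>G\<^esub> z \<longleftrightarrow> (2, 4) \<in> E" "z \<rightarrow>\<^bsub>G\<^esub> x \<longleftrightarrow> (4, 0) \<in> E"
    for a b c x y z and E :: "nat rel"
    using hexagon_contains_C6_plus[of a b c x y z E] that free[of E] by blast
  \<comment> \<open>The conjuncts exclude the patterns with no edge, with
    \<open>x\<close>-\<open>y\<close> alone, with exactly \<open>x\<close>-\<open>y\<close> and
    \<open>y\<close>-\<open>z\<close>, and with all three. The other four of the eight patterns are
    rotations of the second and third of these.\<close>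
  have **: "(x \<rightarrow>\<^bsub>G\<^esub> y \<or> y \<rightarrow>\<^bsub>G\<^esub> z \<or> z \<rightarrow>\<^bsub>G\<^esub> x) \<and> (x \<rightarrow>\<^bsub>G\<^esub> y \<longrightarrow> y \<rightarrow>\<^bsub>G\<^esub> z \<or> z \<rightarrow>\<^bsub>G\<^esub> x) \<and>
      (x \<rightarrow>\<^bsub>G\<^esub> y \<and> y \<rightarrow>\<^bsub>G\<^esub> z \<longrightarrow> z \<rightarrow>\<^bsub>G\<^esub> x) \<and> \<not> (x \<rightarrow>\<^bsub>G\<^esub> y \<and> y \<rightarrow>\<^bsub>G\<^esub> z \<and> z \<rightarrow>\<^bsub>G\<^esub> x)"
    if "hexagon G a b c x y z" for a b c x y z
    using *[OF that, of "{}"] *[OF that, of "{(0, 2)}"] *[OF that, of "{(0, 2), (2, 4)}"]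
      *[OF that, of "{(0, 2), (2, 4), (4, 0)}"] by simp blast
  show False using **[OF hex] **[OF hex'] **[OF hex''] by blast
qed

section \<open>The Helly property of cliques of the auxiliary graph\<close>

lemma dominates_aux_graph_iff:
  "u \<rightarrow>\<^bsub>with_proj (aux_graph G)\<^esub> v \<longleftrightarrow> u \<in> verts G \<and> v \<in> verts G \<and> graph_dist G u v = 2"
  by (simp add: aux_graph_def)

lemma (in graph) clique_aux_graph_common_neighbour:
  assumes no_isolated: "\<And>v. v \<in> verts G \<Longrightarrow> neighbourhood G v \<noteq> {}"
    and H_free: "\<And>H. H \<in> C6_family \<Longrightarrow> \<not> contains_induced G (with_proj H)"
    and "clique (with_proj (aux_graph G)) K" "K \<noteq> {}"
  shows "\<exists>v \<in> verts G. K \<subseteq> neighbourhood G v"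
proof -
  have "finite K" using assms(3) finite_verts
    by (auto simp: clique_def aux_graph_def intro: finite_subset)
  then show ?thesis using assms(3,4)
  \<comment> \<open>The induction hypothesis for proper subsets stands in for the choice of a
    minimal counterexample.\<close>
  proof (induction rule: finite_psubset_induct)
    case (psubset K)
    have verts: "K \<subseteq> verts G" using psubset.prems by (simp add: clique_def aux_graph_def)
    have far: "\<not> u \<rightarrow>\<^bsub>G\<^esub> v \<and> (\<exists>w. u \<rightarrow>\<^bsub>G\<^esub> w \<and> w \<rightarrow>\<^bsub>G\<^esub> v)"
      if "u \<in> K" "v \<in> K" "u \<noteq> v" for u v
    proof -
      have "graph_dist G u v = 2"
        using psubset.prems that
        unfolding clique_def by (auto simp: aux_graph_def dest: pairwiseD)
      then show ?thesis using graph_dist_eq_2_iff that verts by blast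
    qed
    obtain a where a: "a \<in> K" using psubset.prems by blast
    show ?case
    proof (rule ccontr)
      assume none: "\<not> ?case"
      have none': "\<exists>k \<in> K. \<not> v \<rightarrow>\<^bsub>G\<^esub> k" for v
        using none adj_in_verts(1)[of v] a by (auto simp: neighbourhood_def)
      have "K \<noteq> {a}"
      proof
        assume "K = {a}"
        moreover obtain v where "a \<rightarrow>\<^bsub>G\<^esub> v"
          using no_isolated a verts by (auto simp: neighbourhood_def)
        ultimately show False using none'[of v] dominates_sym by auto
      qed
      then obtain b where b: "b \<in> K" "b \<noteq> a" using a by blast
      \<comment> \<open>Two vertices at distance two have the midpoint of a shortest path as common
        neighbour.\<close>
      have "K \<noteq> {a, b}"
      proof
        assume "K = {a, b}"
        moreover obtain w where "a \<rightarrow>\<^bsub>G\<^esub> w" "w \<rightarrow>\<^bsub>G\<^esub> b" using far a b by blast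
        ultimately show False using none'[of w] dominates_sym by auto
      qed
      then obtain c where c: "c \<in> K" "c \<noteq> a" "c \<noteq> b" using a b by blast
      \<comment> \<open>The clique \<open>K - {k}\<close> has a common neighbour by induction; were
        it adjacent to \<open>k\<close> too, it would serve for all of \<open>K\<close>.\<close>
      have omit: "\<exists>v. \<not> v \<rightarrow>\<^bsub>G\<^esub> k \<and> (\<forall>l \<in> K - {k}. v \<rightarrow>\<^bsub>G\<^esub> l)" if "k \<in> K" for k
      proof -
        have "clique (with_proj (aux_graph G)) (K - {k})"
          using psubset.prems unfolding clique_def by (auto intro: pairwise_subset)
        moreover have "K - {k} \<noteq> {}" "K - {k} \<subset> K" using that a b by auto
        ultimately obtain v where "K - {k} \<subseteq> neighbourhood G v" using psubset.IH by blast
        then have "\<forall>l \<in> K - {k}. v \<rightarrow>\<^bsub>G\<^esub> l" by (auto simp: neighbourhood_def)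
        then show ?thesis using none'[of v] by blast
      qed
      obtain x y z where
        "\<not> x \<rightarrow>\<^bsub>G\<^esub> a" "\<forall>l \<in> K - {a}. x \<rightarrow>\<^bsub>G\<^esub> l"
        "\<not> y \<rightarrow>\<^bsub>G\<^esub> b" "\<forall>l \<in> K - {b}. y \<rightarrow>\<^bsub>G\<^esub> l"
        "\<not> z \<rightarrow>\<^bsub>G\<^esub> c" "\<forall>l \<in> K - {c}. z \<rightarrow>\<^bsub>G\<^esub> l"
        using omit[OF a] omit[OF b(1)] omit[OF c(1)] by blast
      then have "hexagon G a b c x y z"
        unfolding hexagon_def using a b c far by auto
      then show False using no_hexagon[OF H_free] by blast
    qed
  qed
qed

section \<open>Translation between colourings and clique covers\<close>

text \<open>The vertex \<open>w\<close> is the midpoint of a path of length two between any two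
  members of \<open>K\<close>, and independence rules out a shorter path.\<close>

lemma (in graph) clique_aux_graphI:
  assumes "K \<subseteq> neighbourhood G w" "\<And>u v. u \<in> K \<Longrightarrow> v \<in> K \<Longrightarrow> \<not> u \<rightarrow>\<^bsub>G\<^esub> v"
  shows "clique (with_proj (aux_graph G)) K"
proof -
  have w: "w \<rightarrow>\<^bsub>G\<^esub> u" "u \<in> verts G" if "u \<in> K" for u
    using assms(1) that adj_in_verts(2) by (auto simp: neighbourhood_def)
  have "graph_dist G u v = 2" if "u \<in> K" "v \<in> K" "u \<noteq> v" for u v
  proof -
    have "u \<rightarrow>\<^bsub>G\<^esub> w" using w(1)[OF \<open>u \<in> K\<close>] by (simp only: dominates_sym[of u w])
    then show ?thesis
      using graph_dist_eq_2_iff[OF w(2)[OF \<open>u \<in> K\<close>]] w(1) assms(2) that by blast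
  qed
  then show ?thesis
    unfolding clique_def pairwise_def dominates_aux_graph_iff using w by (auto simp: aux_graph_def)
qed

text \<open>The cover consists of the colour classes. Only colours that occur are used, so classes
  are nonempty and distinct colours give distinct classes.\<close>

lemma (in graph) clique_cover_of_cd_colouring:
  assumes "cd_colouring G c"
  shows "\<exists>P. clique_cover (with_proj (aux_graph G)) P \<and> card P = card (c ` verts G)"
proof -
  define cls where "cls i = {u \<in> verts G. c u = i}" for i
  define P where "P = cls ` c ` verts G"
  have "inj_on cls (c ` verts G)" by (auto simp: inj_on_def cls_def)
  then have "card P = card (c ` verts G)" unfolding P_def by (rule card_image)
  moreover have "partition_on (verts G) P"
    by (rule partition_onI) (auto simp: P_def cls_def disjnt_def)
  moreover have "clique (with_proj (aux_graph G)) (cls i)" if i: "i \<in> c ` verts G" for i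
  proof -
    obtain w where "cls i \<subseteq> neighbourhood G w"
      using assms i unfolding cd_colouring_def cls_def by blast
    then show ?thesis
    proof (rule clique_aux_graphI)
      fix u v assume "u \<in> cls i" "v \<in> cls i"
      then have "c u = c v" by (simp add: cls_def)
      then show "\<not> u \<rightarrow>\<^bsub>G\<^esub> v"
        using assms unfolding cd_colouring_def proper_colouring_def by blast
    qed
  qed
  ultimately show ?thesis
    by (intro exI[of _ P]) (auto simp: clique_cover_def P_def aux_graph_def)
qed

text \<open>The parts are numbered injectively and each vertex gets the number of its part. Members
  of one part are at distance two, so the colouring is proper; the Helly property puts each class
  inside a neighbourhood.\<close>

lemma (in graph) cd_colouring_of_clique_cover:
  assumes no_isolated: "\<And>v. v \<in> verts G \<Longrightarrow> neighbourhood G v \<noteq> {}"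
    and H_free: "\<And>H. H \<in> C6_family \<Longrightarrow> \<not> contains_induced G (with_proj H)"
    and P: "clique_cover (with_proj (aux_graph G)) P"
  shows "\<exists>c. cd_colouring G c \<and> card (c ` verts G) = card P"
proof -
  have part: "partition_on (verts G) P" and cliques: "\<And>K. K \<in> P \<Longrightarrow> clique (with_proj (aux_graph G)) K"
    using P by (auto simp: clique_cover_def aux_graph_def)
  obtain e :: "'a set \<Rightarrow> nat" where e: "inj_on e P"
    using P finite_imp_inj_to_nat_seg unfolding clique_cover_def by meson
  define part_of where "part_of u = (THE K. K \<in> P \<and> u \<in> K)" for u
  have part_of_eq: "part_of u = K" if "K \<in> P" "u \<in> K" for u K
    unfolding part_of_def using that partition_onD2[OF part]
    by (intro the_equality) (auto simp: disjoint_def)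
  have part_of: "part_of u \<in> P" "u \<in> part_of u" if "u \<in> verts G" for u
  proof -
    obtain K where "K \<in> P" "u \<in> K" using partition_onD1[OF part] \<open>u \<in> verts G\<close> by blast
    then show "part_of u \<in> P" "u \<in> part_of u" using part_of_eq by auto
  qed
  define c where "c u = e (part_of u)" for u
  have same: "part_of u = part_of v" if "u \<in> verts G" "v \<in> verts G" "c u = c v" for u v
    using that e part_of by (auto simp: c_def inj_on_eq_iff)
  have "part_of ` verts G = P"
  proof
    show "P \<subseteq> part_of ` verts G"
    proof
      fix K assume K: "K \<in> P"
      then obtain u where "u \<in> K" using partition_onD3[OF part] by fastforce
      then show "K \<in> part_of ` verts G"
        using K part_of_eq partition_onD1[OF part] by blast
    qed
  qed (use part_of in auto)
  then have "c ` verts G = e ` P" by (auto simp: c_def)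
  then have "card (c ` verts G) = card P" using card_image[OF e] by simp
  moreover have "proper_colouring G c"
    unfolding proper_colouring_def
  proof (intro allI impI notI)
    fix u v assume uv: "u \<rightarrow>\<^bsub>G\<^esub> v" "c u = c v"
    then have V: "u \<in> verts G" "v \<in> verts G" using adj_in_verts by auto
    have "u \<noteq> v" using uv dominates_irrefl by auto
    moreover have "v \<in> part_of u" using same[OF V uv(2)] part_of(2)[OF V(2)] by simp
    ultimately have "graph_dist G u v = 2"
      using cliques[OF part_of(1)[OF V(1)]] part_of(2)[OF V(1)]
      unfolding clique_def pairwise_def dominates_aux_graph_iff by blast
    then show False using graph_dist_eq_2_iff V uv by blast
  qed
  moreover have "\<exists>w \<in> verts G. {u \<in> verts G. c u = i} \<subseteq> neighbourhood G w"
    if i: "i \<in> c ` verts G" for i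
  proof -
    obtain v where v: "v \<in> verts G" "i = c v" using i by blast
    have "{u \<in> verts G. c u = i} \<subseteq> part_of v"
    proof
      fix u assume "u \<in> {u \<in> verts G. c u = i}"
      then have u: "u \<in> verts G" "c u = c v" using v(2) by auto
      show "u \<in> part_of v" using part_of(2)[OF u(1)] unfolding same[OF u(1) v(1) u(2)] .
    qed
    moreover have "\<exists>w \<in> verts G. part_of v \<subseteq> neighbourhood G w"
      using clique_aux_graph_common_neighbour[OF no_isolated H_free cliques] part_of[OF v(1)]
      by blast
    ultimately show ?thesis by blast
  qed
  ultimately show ?thesis unfolding cd_colouring_def by blast
qed

theorem theorem8:
  fixes G :: "('a, 'b) pre_digraph"
  assumes "graph G"
    and no_isolated: "\<And>v. v \<in> verts G \<Longrightarrow> neighbourhood G v \<noteq> {}"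
    and H_free: "\<And>H. H \<in> C6_family \<Longrightarrow> \<not> contains_induced G (with_proj H)"
  shows "cd_chromatic_number G = clique_cover_number (with_proj (aux_graph G))"
proof -
  interpret graph G by fact
  \<comment> \<open>Both minima range over the same set of sizes, so they agree.\<close>
  have "(\<exists>c. cd_colouring G c \<and> card (c ` verts G) = k) \<longleftrightarrow>
      (\<exists>P. clique_cover (with_proj (aux_graph G)) P \<and> card P = k)" for k
    using clique_cover_of_cd_colouring cd_colouring_of_clique_cover[OF no_isolated H_free]
    by metis
  then show ?thesis unfolding cd_chromatic_number_def clique_cover_number_def by simp
qed

end
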